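(* Let $f:\mathbb R^n\to\mathbb R^n$ be of class $\mathcal C^1$, let $\mathcal P:\Pi_1\to\Pi_2$ be a Poincaré map for $x'=f(x)$, and let $X\subset\Pi_1$ be contained in the domain of $\mathcal P$. Suppose the algorithm computePoincareMap described in the context is called with its arguments $[t_1,t_2]$, $X_1$, $f$, $y$, $A$, and let $\mathbf{z}$ be the computed result. Then $$A(\mathcal P(X)-y)\subset\mathbf{z}.$$
   Context: Let $\varphi$ be the local flow of $x'=f(x)$. A Poincaré section is a connected codimension-one manifold to which $f$ is transversal at every point. For sections $\Pi_1,\Pi_2$, the return time is $t_{\mathcal P}(x)=\inf\{t>0:\varphi(t,x)\in\Pi_2\}$ for $x\in\Pi_1$ (defined when such $t$ exists), and $\mathcal P(x)=\varphi(t_{\mathcal P}(x),x)$. Interval conventions: interval vectors (matrices) are products of closed bounded intervals; arithmetic operations on intervals, interval vectors and interval matrices are interval operations, which enclose the exact results of the operation over all choices of elements; $[S]_I$ denotes the interval hull of a set $S$ (the smallest product of closed intervals containing $S$); $[g]$ denotes a fixed interval extension of a function $g$, i.e. $[g](\mathbf{v})$ is an interval vector (matrix) containing $g(\mathbf{v})$. Algorithm computePoincareMap. Input: an interval $[t_1,t_2]$ with $t_{\mathcal P}(X)\subset[t_1,t_2]$; a set $X_1\subset\mathbb R^n$ with $\varphi(t_1,X)\subset X_1$; the vector field $f$; a vector $y\in\mathbb R^n$; a linear map $A$ on $\mathbb R^n$. Steps: 1. compute an interval vector $\mathbf{e}\supset\varphi([0,t_2-t_1],X_1)$ (in particular the flow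 is defined there); 2. $t_0=(t_1+t_2)/2$; 3. $\mathbf{\Delta t}=[t_1,t_2]-t_0$; 4. compute a set $X_0\supset\varphi(t_0-t_1,X_1)$; 5. compute an interval vector $\mathbf{Y_0}\supset A(X_0-y)$; 6. $\mathbf{Y}=\mathbf{v}\cdot\mathbf{\Delta t}$, where $\mathbf{v}$ is an interval vector with $\mathbf{v}\supset A(f(X_0))$; 7. $\mathbf{\Delta Y}=\tfrac12 A\cdot[Df](\mathbf{e})\cdot[f](\mathbf{e})\cdot\mathbf{\Delta t}^2$; 8. return $\mathbf{z}=(\mathbf{Y_0}+\mathbf{Y}+\mathbf{\Delta Y})\cap[A(\mathbf{e}-y)]_I$. *)

theory Defs
  imports "HOL-Analysis.Analysis"
begin

text \<open>Only meant for open \<open>U\<close>.\<close>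

definition C1_on :: "('a::real_normed_vector \<Rightarrow> 'b::real_normed_vector) \<Rightarrow> 'a set \<Rightarrow> bool" where
  "C1_on g U \<longleftrightarrow>
    (\<exists>g'. (\<forall>x\<in>U. (g has_derivative blinfun_apply (g' x)) (at x)) \<and> continuous_on U g')"

definition ivp_solution ::
  "(real^'n \<Rightarrow> real^'n) \<Rightarrow> real^'n \<Rightarrow> real set \<Rightarrow> (real \<Rightarrow> real^'n) \<Rightarrow> bool" where
  "ivp_solution f x I u \<longleftrightarrow>
    open I \<and> is_interval I \<and> 0 \<in> I \<and> u 0 = x \<and>
    (\<forall>t\<in>I. (u has_vector_derivative f (u t)) (at t))"

definition existence_interval :: "(real^'n \<Rightarrow> real^'n) \<Rightarrow> real^'n \<Rightarrow> real set" where
  "existence_interval f x = \<Union>{I. \<exists>u. ivp_solution f x I u}"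

text \<open>The value is meaningful only for \<open>t \<in> existence_interval f x\<close>; uniqueness of
  solutions, which holds for C1 vector fields, makes the description well defined there.\<close>

definition flow :: "(real^'n \<Rightarrow> real^'n) \<Rightarrow> real \<Rightarrow> real^'n \<Rightarrow> real^'n" where
  "flow f t x = (THE z. \<exists>I u. ivp_solution f x I u \<and> t \<in> I \<and> u t = z)"

text \<open>The inclusion of \<open>\<phi>(T, S)\<close> in \<open>R\<close>, including the requirement that the flow is defined
  on all of \<open>T \<times> S\<close>.\<close>

definition flow_maps_into ::
  "(real^'n \<Rightarrow> real^'n) \<Rightarrow> real set \<Rightarrow> (real^'n) set \<Rightarrow> (real^'n) set \<Rightarrow> bool" where
  "flow_maps_into f T S R \<longleftrightarrow>
    (\<forall>t\<in>T. \<forall>x\<in>S. t \<in> existence_interval f x \<and> flow f t x \<in> R)"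

text \<open>Embedded codimension-one submanifolds, given locally as regular level sets.\<close>

definition codim1_manifold :: "(real^'n) set \<Rightarrow> bool" where
  "codim1_manifold S \<longleftrightarrow>
    (\<forall>p\<in>S. \<exists>U (h :: real^'n \<Rightarrow> real).
      open U \<and> p \<in> U \<and> C1_on h U \<and>
      (\<forall>x\<in>U. frechet_derivative h (at x) \<noteq> (\<lambda>_. 0)) \<and>
      S \<inter> U = {x \<in> U. h x = 0})"

definition tangent_space :: "(real^'n) set \<Rightarrow> real^'n \<Rightarrow> (real^'n) set" where
  "tangent_space S p =
    {v. \<exists>\<gamma> \<epsilon>. \<epsilon> > 0 \<and> \<gamma> 0 = p \<and> (\<forall>t. \<bar>t\<bar> < \<epsilon> \<longrightarrow> \<gamma> t \<in> S) \<and>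
          (\<gamma> has_vector_derivative v) (at (0::real))}"

definition transversal_at :: "(real^'n \<Rightarrow> real^'n) \<Rightarrow> (real^'n) set \<Rightarrow> real^'n \<Rightarrow> bool" where
  "transversal_at f S p \<longleftrightarrow> span (insert (f p) (tangent_space S p)) = UNIV"

definition poincare_section :: "(real^'n \<Rightarrow> real^'n) \<Rightarrow> (real^'n) set \<Rightarrow> bool" where
  "poincare_section f S \<longleftrightarrow>
    connected S \<and> codim1_manifold S \<and> (\<forall>p\<in>S. transversal_at f S p)"

definition hitting_times ::
  "(real^'n \<Rightarrow> real^'n) \<Rightarrow> (real^'n) set \<Rightarrow> real^'n \<Rightarrow> real set" where
  "hitting_times f S x = {t. t > 0 \<and> t \<in> existence_interval f x \<and> flow f t x \<in> S}"

definition return_time ::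
  "(real^'n \<Rightarrow> real^'n) \<Rightarrow> (real^'n) set \<Rightarrow> real^'n \<Rightarrow> real" where
  "return_time f S x = Inf (hitting_times f S x)"

definition poincare_domain ::
  "(real^'n \<Rightarrow> real^'n) \<Rightarrow> (real^'n) set \<Rightarrow> (real^'n) set \<Rightarrow> (real^'n) set" where
  "poincare_domain f S1 S2 = {x \<in> S1. hitting_times f S2 x \<noteq> {}}"

definition poincare_map ::
  "(real^'n \<Rightarrow> real^'n) \<Rightarrow> (real^'n) set \<Rightarrow> real^'n \<Rightarrow> real^'n" where
  "poincare_map f S x = flow f (return_time f S x) x"

text \<open>For the types \<open>real\<close>, \<open>real^'n\<close> and \<open>real^'n^'m\<close> these are exactly the (nonempty)
  intervals, interval vectors and interval matrices, since \<open>cbox\<close> bounds every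
  component (matrix entry) separately.\<close>

definition interval_box :: "'a::euclidean_space set \<Rightarrow> bool" where
  "interval_box R \<longleftrightarrow> R \<noteq> {} \<and> (\<exists>a b. R = cbox a b)"

definition interval_hull :: "'a::euclidean_space set \<Rightarrow> 'a set" where
  "interval_hull S = \<Inter>{R. interval_box R \<and> S \<subseteq> R}"

text \<open>\<open>R\<close> is an admissible result of the interval version of an operation applied to \<open>S\<close>
  and \<open>T\<close>. Only enclosure is demanded, so that both optimal and outward-rounded
  operations are covered. Exact operands are singletons.\<close>

definition interval_op ::
  "('a \<Rightarrow> 'b \<Rightarrow> 'c::euclidean_space) \<Rightarrow> 'a set \<Rightarrow> 'b set \<Rightarrow> 'c set \<Rightarrow> bool" where
  "interval_op opr S T R \<longleftrightarrow> interval_box R \<and> (\<forall>s\<in>S. \<forall>t\<in>T. opr s t \<in> R)"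

definition interval_extension ::
  "('a::euclidean_space \<Rightarrow> 'b::euclidean_space) \<Rightarrow> ('a set \<Rightarrow> 'b set) \<Rightarrow> bool" where
  "interval_extension g G \<longleftrightarrow>
    (\<forall>v. interval_box v \<longrightarrow> interval_box (G v) \<and> g ` v \<subseteq> G v)"

text \<open>The algorithm leaves the choice of its enclosures open, so it is a relation between its
  arguments and the possible results \<open>z\<close>. The parameters \<open>fI\<close> and \<open>DfI\<close> are the interval
  extensions of \<open>f\<close> and of its Jacobian. The product defining \<open>\<Delta>Y\<close> is evaluated from left to
  right through \<open>M\<^sub>1\<close>, \<open>M\<^sub>2\<close>, \<open>w\<close>; \<open>D\<close> is the interval square of \<open>\<Delta>t\<close>.\<close>

definition computePoincareMap ::
  "((real^'n) set \<Rightarrow> (real^'n) set) \<Rightarrow> ((real^'n) set \<Rightarrow> (real^'n^'n) set) \<Rightarrow>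
   real \<Rightarrow> real \<Rightarrow> (real^'n) set \<Rightarrow> (real^'n \<Rightarrow> real^'n) \<Rightarrow> real^'n \<Rightarrow>
   (real^'n \<Rightarrow> real^'n) \<Rightarrow> (real^'n) set \<Rightarrow> bool" where
  "computePoincareMap fI DfI t\<^sub>1 t\<^sub>2 X\<^sub>1 f y A z \<longleftrightarrow>
    (\<exists>e t\<^sub>0 \<Delta>t X\<^sub>0 Y\<^sub>0 v Y M\<^sub>1 M\<^sub>2 w D \<Delta>Y Z\<^sub>1 Z\<^sub>2.
      interval_box e \<and> flow_maps_into f {0..t\<^sub>2 - t\<^sub>1} X\<^sub>1 e \<and>
      t\<^sub>0 = (t\<^sub>1 + t\<^sub>2) / 2 \<and>
      interval_op (-) {t\<^sub>1..t\<^sub>2} {t\<^sub>0} \<Delta>t \<and>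
      flow_maps_into f {t\<^sub>0 - t\<^sub>1} X\<^sub>1 X\<^sub>0 \<and>
      interval_box Y\<^sub>0 \<and> (\<lambda>x. A (x - y)) ` X\<^sub>0 \<subseteq> Y\<^sub>0 \<and>
      interval_box v \<and> (\<lambda>x. A (f x)) ` X\<^sub>0 \<subseteq> v \<and>
      interval_op (\<lambda>a t. t *\<^sub>R a) v \<Delta>t Y \<and>
      interval_op (*\<^sub>R) {1/2} {matrix A} M\<^sub>1 \<and>
      interval_op (**) M\<^sub>1 (DfI e) M\<^sub>2 \<and>
      interval_op (*v) M\<^sub>2 (fI e) w \<and>
      interval_box D \<and> (\<lambda>t. t\<^sup>2) ` \<Delta>t \<subseteq> D \<and>
      interval_op (\<lambda>a t. t *\<^sub>R a) w D \<Delta>Y \<and>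
      interval_op (+) Y\<^sub>0 Y Z\<^sub>1 \<and>
      interval_op (+) Z\<^sub>1 \<Delta>Y Z\<^sub>2 \<and>
      z = Z\<^sub>2 \<inter> interval_hull ((\<lambda>x. A (x - y)) ` e))"

end

theory Submission
  imports Defs
begin

text \<open>On a compact time interval two solutions of a C1 equation that meet coincide, because \<open>f\<close> is
  Lipschitz on the convex hull of their ranges. Hence \<open>P(x)\<close> is reached from
  \<open>\<phi>(t\<^sub>1, x) \<in> X\<^sub>1\<close> along the solution that the algorithm encloses. Each component of \<open>A\<close> applied
  to this solution is expanded around \<open>t\<^sub>0\<close> with second-order Lagrange remainder. The intermediate
  times depend on the component, but the remainder vector still lies in the computed enclosure
  since that is a box.\<close>

section \<open>Uniqueness of solutions of a C1 equation\<close>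

text \<open>The continuous derivative is bounded on the compact set, and convexity lets the mean
  value inequality turn that bound into a Lipschitz constant.\<close>

lemma C1_lipschitz_on_compact_convex:
  fixes g :: "'a::real_normed_vector \<Rightarrow> 'b::real_normed_vector"
  assumes "C1_on g U" "compact K" "convex K" "K \<subseteq> U"
  obtains L where "0 \<le> L" "\<And>x y. x \<in> K \<Longrightarrow> y \<in> K \<Longrightarrow> norm (g x - g y) \<le> L * norm (x - y)"
proof -
  obtain g' where g': "\<And>x. x \<in> U \<Longrightarrow> (g has_derivative blinfun_apply (g' x)) (at x)"
    and c: "continuous_on U g'"
    using assms(1) unfolding C1_on_def by blast
  have "bounded (g' ` K)"
    using assms(2,4) c by (meson compact_continuous_image compact_imp_bounded continuous_on_subset)
  then obtain B where B: "B > 0" "\<And>x. x \<in> K \<Longrightarrow> norm (g' x) \<le> B"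
    by (auto simp: bounded_pos)
  have "norm (g x - g y) \<le> B * norm (x - y)" if "x \<in> K" "y \<in> K" for x y
  proof (rule differentiable_bound[OF assms(3) _ _ that])
    show "(g has_derivative blinfun_apply (g' z)) (at z within K)" if "z \<in> K" for z
      using g' that assms(4) by (blast intro: has_derivative_at_withinI)
    show "onorm (blinfun_apply (g' z)) \<le> B" if "z \<in> K" for z
      using B(2)[OF that] by (simp add: norm_blinfun.rep_eq)
  qed
  with B(1) show thesis by (intro that[of B]) auto
qed

text \<open>A Gronwall argument: the squared distance \<open>d\<close> of the two solutions
  satisfies \<open>d' \<le> 2 * L * d\<close>, so \<open>d\<close> times
  \<open>exp (- 2 * L * t)\<close> is nonincreasing. It vanishes at \<open>a\<close> and is never
  negative, so it vanishes at \<open>b\<close>.\<close>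

lemma lipschitz_ode_unique_forward:
  fixes u v :: "real \<Rightarrow> 'a::real_inner"
  assumes "a \<le> b" "u a = v a"
    and u: "\<And>t. t \<in> {a..b} \<Longrightarrow> (u has_vector_derivative f (u t)) (at t)"
    and v: "\<And>t. t \<in> {a..b} \<Longrightarrow> (v has_vector_derivative f (v t)) (at t)"
    and lip: "\<And>t. t \<in> {a..b} \<Longrightarrow> norm (f (u t) - f (v t)) \<le> L * norm (u t - v t)"
  shows "u b = v b"
proof -
  define q where "q t = ((u t - v t) \<bullet> (u t - v t)) * exp (- 2 * L * t)" for t
  have "\<exists>d. (q has_real_derivative d) (at t) \<and> d \<le> 0" if "a \<le> t" "t \<le> b" for t
  proof -
    have t: "t \<in> {a..b}" using that by simp
    have d: "((\<lambda>t. u t - v t) has_derivative (\<lambda>h. h *\<^sub>R (f (u t) - f (v t)))) (at t)"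
      using has_vector_derivative_diff[OF u[OF t] v[OF t]] by (simp add: has_vector_derivative_def)
    have "((\<lambda>t. (u t - v t) \<bullet> (u t - v t)) has_real_derivative
        2 * ((u t - v t) \<bullet> (f (u t) - f (v t)))) (at t)"
      unfolding has_field_derivative_def
      by (rule has_derivative_eq_rhs[OF has_derivative_inner[OF d d]])
        (auto simp: inner_commute algebra_simps)
    moreover have "((\<lambda>t. exp (- 2 * L * t)) has_real_derivative - 2 * L * exp (- 2 * L * t)) (at t)"
      by (auto intro!: derivative_eq_intros)
    ultimately have "(q has_real_derivative
        (2 * ((u t - v t) \<bullet> (f (u t) - f (v t))) - 2 * L * ((u t - v t) \<bullet> (u t - v t)))
          * exp (- 2 * L * t)) (at t)"
      unfolding q_def by (rule DERIV_cong[OF DERIV_mult]) (simp add: left_diff_distrib)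
    moreover have "(u t - v t) \<bullet> (f (u t) - f (v t)) \<le> L * ((u t - v t) \<bullet> (u t - v t))"
    proof -
      have "(u t - v t) \<bullet> (f (u t) - f (v t)) \<le> norm (u t - v t) * norm (f (u t) - f (v t))"
        by (rule norm_cauchy_schwarz)
      also have "\<dots> \<le> norm (u t - v t) * (L * norm (u t - v t))"
        by (intro mult_left_mono lip t) auto
      finally show ?thesis by (simp add: dot_square_norm power2_eq_square algebra_simps)
    qed
    ultimately show ?thesis
      by (intro exI[of _ "(2 * ((u t - v t) \<bullet> (f (u t) - f (v t)))
          - 2 * L * ((u t - v t) \<bullet> (u t - v t))) * exp (- 2 * L * t)"] conjI)
        (simp_all add: mult_le_0_iff)
  qed
  then have "q b \<le> q a" using DERIV_nonpos_imp_nonincreasing[OF assms(1)] by blast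
  then have "(u b - v b) \<bullet> (u b - v b) * exp (- 2 * L * b) \<le> 0" by (simp add: q_def assms(2))
  then have "(u b - v b) \<bullet> (u b - v b) \<le> 0" by (simp add: mult_le_0_iff not_le)
  then show ?thesis using inner_ge_zero[of "u b - v b"] by (simp add: order_antisym)
qed

lemma has_vector_derivative_reflect:
  assumes "(u has_vector_derivative d) (at (- t))"
  shows "((\<lambda>s. u (- s)) has_vector_derivative - d) (at (t::real))"
proof -
  have "((\<lambda>s. - s) has_vector_derivative - 1) (at t)"
    by (rule has_vector_derivative_minus[OF has_vector_derivative_id])
  from vector_diff_chain_at[OF this assms] show ?thesis by (simp add: o_def)
qed

lemma C1_ode_unique:
  fixes u v :: "real \<Rightarrow> 'a::euclidean_space"
  assumes C1: "C1_on f UNIV" and "is_interval J" "a \<in> J" "b \<in> J" "u a = v a"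
    and u: "\<And>t. t \<in> J \<Longrightarrow> (u has_vector_derivative f (u t)) (at t)"
    and v: "\<And>t. t \<in> J \<Longrightarrow> (v has_vector_derivative f (v t)) (at t)"
  shows "u b = v b"
proof -
  \<comment> \<open>\<open>S\<close> is the segment between the two times; it is compact even if
    \<open>J\<close> is not.\<close>
  define S where "S = {min a b..max a b}"
  have S: "S \<subseteq> J"
  proof
    fix t assume "t \<in> S"
    then have t: "min a b \<le> t" "t \<le> max a b" by (simp_all only: S_def atLeastAtMost_iff)
    have "min a b \<in> J" "max a b \<in> J" using assms(3,4) by (simp_all add: min_def max_def)
    from mem_is_interval_1_I[OF assms(2) this t] show "t \<in> J" .
  qed
  have "continuous_on S u" "continuous_on S v"
    by (rule continuous_on_vector_derivative, rule has_vector_derivative_at_within,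
        rule u v, erule subsetD[OF S])+
  \<comment> \<open>The two trajectories need not form a convex set; their hull is convex and still
    compact.\<close>
  then have "compact (convex hull (u ` S \<union> v ` S))"
    by (intro compact_convex_hull compact_Un compact_continuous_image) (auto simp: S_def)
  then obtain L where L: "\<And>x y. x \<in> convex hull (u ` S \<union> v ` S) \<Longrightarrow>
      y \<in> convex hull (u ` S \<union> v ` S) \<Longrightarrow> norm (f x - f y) \<le> L * norm (x - y)"
    using C1_lipschitz_on_compact_convex[OF C1 _ convex_convex_hull subset_UNIV] by blast
  have lip: "norm (f (u t) - f (v t)) \<le> L * norm (u t - v t)" if "t \<in> S" for t
    using that by (intro L hull_inc) auto
  show ?thesis
  proof (cases "a \<le> b")
    case True
    then have "S = {a..b}" by (simp add: S_def)
    then show ?thesis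
      using lipschitz_ode_unique_forward[of a b u v f L] True S u v lip assms(5) by blast
  next
    case False
    have neg: "- t \<in> S" if "t \<in> {-a..-b}" for t
      using that False by (auto simp: S_def)
    \<comment> \<open>Time reversal gives solutions of the equation with field \<open>- f\<close>,
      which has the same Lipschitz constant, and turns the backward case into the forward one from
      \<open>- a\<close> to \<open>- b\<close>.\<close>
    have "u (- (- b)) = v (- (- b))"
    proof (rule lipschitz_ode_unique_forward[where f = "\<lambda>x. - f x" and L = L
          and a = "- a" and b = "- b" and u = "\<lambda>t. u (- t)" and v = "\<lambda>t. v (- t)"])
      fix t assume "t \<in> {-a..-b}"
      then have t: "- t \<in> S" by (rule neg)
      show "((\<lambda>t. u (- t)) has_vector_derivative - f (u (- t))) (at t)"
        and "((\<lambda>t. v (- t)) has_vector_derivative - f (v (- t))) (at t)"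
        using t S u v by (auto intro: has_vector_derivative_reflect)
      show "norm (- f (u (- t)) - - f (v (- t))) \<le> L * norm (u (- t) - v (- t))"
        using lip[OF t] by (simp add: norm_minus_commute)
    qed (use False assms(5) in auto)
    then show ?thesis by simp
  qed
qed

section \<open>The flow and its existence intervals\<close>

text \<open>Any two solutions through \<open>x\<close> agree on the intersection of their intervals,
  so the definite description has a unique value and every solution computes it.\<close>

lemma flow_eq_solution:
  assumes "C1_on f UNIV" "ivp_solution f x I u" "t \<in> I"
  shows "flow f t x = u t"
  unfolding flow_def
proof (rule the_equality)
  fix z assume "\<exists>I u. ivp_solution f x I u \<and> t \<in> I \<and> u t = z"
  then obtain J v where v: "ivp_solution f x J v" "t \<in> J" "v t = z" by blast
  have "v t = u t"
  proof (rule C1_ode_unique[OF assms(1), where J = "I \<inter> J" and a = 0])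
    show "is_interval (I \<inter> J)"
      using v assms by (intro is_interval_Int) (simp_all add: ivp_solution_def)
  qed (use v assms in \<open>auto simp: ivp_solution_def\<close>)
  with v show "z = u t" by simp
qed (use assms in blast)

lemma existence_interval_iff:
  "t \<in> existence_interval f x \<longleftrightarrow> (\<exists>I u. ivp_solution f x I u \<and> t \<in> I)"
  by (auto simp: existence_interval_def)

lemma existence_interval_between:
  assumes "s \<in> existence_interval f x" "0 \<le> t" "t \<le> s"
  shows "t \<in> existence_interval f x"
proof -
  obtain I u where u: "ivp_solution f x I u" "s \<in> I"
    using assms(1) unfolding existence_interval_iff by blast
  then have "t \<in> I"
    using mem_is_interval_1_I[of I 0 s t] assms(2,3) by (simp add: ivp_solution_def)
  with u show ?thesis unfolding existence_interval_iff by blast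
qed

lemma has_vector_derivative_shift:
  fixes c :: real
  assumes "(u has_vector_derivative d) (at (t + c))"
  shows "((\<lambda>s. u (s + c)) has_vector_derivative d) (at t)"
proof -
  have "((\<lambda>s. s + c) has_vector_derivative 1) (at t)"
    by (simp add: has_vector_derivative_add_const)
  from vector_diff_chain_at[OF this assms] show ?thesis by (simp add: o_def)
qed

lemma is_interval_shift_vimage:
  fixes I :: "real set"
  assumes "is_interval I"
  shows "is_interval ((\<lambda>s. s + c) -` I)"
  unfolding is_interval_1
proof (intro allI ballI impI, elim conjE)
  fix p q r assume "p \<in> (\<lambda>s. s + c) -` I" "q \<in> (\<lambda>s. s + c) -` I" "p \<le> r" "r \<le> q"
  then show "r \<in> (\<lambda>s. s + c) -` I"
    using mem_is_interval_1_I[OF assms, of "p + c" "q + c" "r + c"] by simp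
qed

text \<open>If \<open>a < 0\<close>, the times \<open>a\<close> and \<open>b\<close> may lie in existence intervals of different solutions
  through \<open>x\<close>; the shifted \<open>u\<close> then meets both at time \<open>0\<close>.\<close>
lemma flow_from_intermediate_point:
  assumes C1: "C1_on f UNIV"
    and a: "a \<in> existence_interval f x" and b: "b \<in> existence_interval f x"
    and "0 \<le> b" "a \<le> b"
    and u: "ivp_solution f (flow f a x) I u" "b - a \<in> I"
  shows "flow f b x = u (b - a)"
proof -
  obtain J v where v: "ivp_solution f x J v" "b \<in> J"
    using b unfolding existence_interval_iff by blast
  have int: "is_interval I" "is_interval J" and mem: "0 \<in> I" "0 \<in> J"
    using u v by (auto simp: ivp_solution_def)
  \<comment> \<open>\<open>u'\<close> is \<open>u\<close> with time counted from \<open>x\<close>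
    instead of from the intermediate point.\<close>
  define u' where "u' = (\<lambda>t. u (t - a))"
  define I' where "I' = (\<lambda>s. s + - a) -` I"
  have I': "is_interval I'" unfolding I'_def by (rule is_interval_shift_vimage[OF int(1)])
  have du: "(u' has_vector_derivative f (u' t)) (at t)" if "t \<in> I'" for t
    using that u(1) has_vector_derivative_shift[of u "f (u' t)" t "- a"]
    by (auto simp: ivp_solution_def I'_def u'_def)
  have bI: "b \<in> I'" using u(2) by (simp add: I'_def)
  have ua: "u' a = flow f a x" "a \<in> I'"
    using u(1) mem by (auto simp: ivp_solution_def u'_def I'_def)
  \<comment> \<open>One common value of \<open>v\<close> and \<open>u'\<close> suffices, as
    uniqueness carries it to \<open>b\<close>. For \<open>0 \<le> a\<close> the time
    \<open>a\<close> lies between \<open>0\<close> and \<open>b\<close>, hence in \<open>J\<close>,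
    and serves as \<open>c\<close>; otherwise \<open>c\<close> is \<open>0\<close>.\<close>
  obtain c where c: "c \<in> I'" "c \<in> J" "v c = u' c"
  proof (cases "0 \<le> a")
    case True
    then have "a \<in> J" using mem_is_interval_1_I[OF int(2) mem(2) v(2)] \<open>a \<le> b\<close> by simp
    moreover from this have "v a = u' a" using flow_eq_solution[OF C1 v(1)] ua(1) by simp
    ultimately show ?thesis using that ua(2) by blast
  next
    case False
    have 0: "0 \<in> I'" using mem_is_interval_1_I[OF I' ua(2) bI] False \<open>0 \<le> b\<close> by simp
    obtain K w where w: "ivp_solution f x K w" "a \<in> K"
      using a unfolding existence_interval_iff by blast
    have "w 0 = u' 0"
    proof (rule C1_ode_unique[OF C1, where J = "K \<inter> I'" and a = a])
      show "is_interval (K \<inter> I')" using w I' by (auto simp: ivp_solution_def intro: is_interval_Int)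
      show "w a = u' a" using flow_eq_solution[OF C1 w] ua(1) by simp
    qed (use w ua 0 du in \<open>auto simp: ivp_solution_def\<close>)
    moreover have "w 0 = v 0" using w v by (simp add: ivp_solution_def)
    ultimately show ?thesis using that[of 0] 0 mem by simp
  qed
  have "v b = u' b"
  proof (rule C1_ode_unique[OF C1, where J = "J \<inter> I'" and a = c])
    show "is_interval (J \<inter> I')" using int I' by (auto intro: is_interval_Int)
  qed (use v bI du c in \<open>auto simp: ivp_solution_def\<close>)
  then show ?thesis using flow_eq_solution[OF C1 v] by (simp add: u'_def)
qed

text \<open>The infimum is not shown to be attained. Existence up to it is inherited from an actual
  hitting time, which is at least as large.\<close>

lemma return_time_in_existence_interval:
  assumes "hitting_times f S x \<noteq> {}"
  shows "0 \<le> return_time f S x" "return_time f S x \<in> existence_interval f x"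
proof -
  obtain s where s: "s \<in> hitting_times f S x" using assms by blast
  have "bdd_below (hitting_times f S x)"
    by (intro bdd_belowI[of _ 0]) (simp add: hitting_times_def)
  then have le: "return_time f S x \<le> s" unfolding return_time_def using s by (rule cInf_lower[rotated])
  show "0 \<le> return_time f S x"
    unfolding return_time_def using assms by (intro cInf_greatest) (auto simp: hitting_times_def)
  with le s show "return_time f S x \<in> existence_interval f x"
    using existence_interval_between[of s f x] by (simp add: hitting_times_def)
qed

section \<open>Boxes and second-order expansion\<close>

text \<open>A box bounds each coordinate separately, so the witness may change with the
  coordinate.\<close>

lemma interval_box_componentwise:
  assumes "interval_box (R :: (real^'n) set)" "\<And>i. \<exists>r\<in>R. x $ i = r $ i"
  shows "x \<in> R"
proof -
  obtain a b where R: "R = cbox a b" using assms(1) by (auto simp: interval_box_def)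
  show ?thesis unfolding R mem_box_cart
  proof
    fix i
    obtain r where "r \<in> R" "x $ i = r $ i" using assms(2) by blast
    then show "a $ i \<le> x $ i \<and> x $ i \<le> b $ i" by (simp add: R mem_box_cart)
  qed
qed

lemma C1_has_derivative_jacobian:
  fixes f :: "real^'n \<Rightarrow> real^'m"
  assumes "C1_on f UNIV"
  shows "(f has_derivative (*v) (jacobian f (at x))) (at x)"
proof -
  have "f differentiable (at x)"
    using assms unfolding C1_on_def by (blast intro: differentiableI)
  then show ?thesis by (simp add: jacobian_works)
qed

text \<open>Since \<open>u' = f(u)\<close> and \<open>f\<close> is C1, the chain rule gives
  \<open>u'' = Df(u) f(u)\<close>. The Lagrange remainder holds for real functions, so it is applied
  to one coordinate and \<xi> depends on \<open>i\<close>.\<close>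

lemma linear_solution_taylor2:
  fixes f :: "real^'n \<Rightarrow> real^'n" and A :: "real^'n \<Rightarrow> real^'m"
  assumes C1: "C1_on f UNIV" and A: "linear A"
    and u: "\<And>t. t \<in> {a..b} \<Longrightarrow> (u has_vector_derivative f (u t)) (at t)"
    and c: "c \<in> {a..b}" and s: "s \<in> {a..b}"
  obtains \<xi> where "\<xi> \<in> {a..b}"
    "A (u s) $ i = A (u c) $ i + (s - c) * A (f (u c)) $ i
      + (s - c)\<^sup>2 / 2 * A (jacobian f (at (u \<xi>)) *v f (u \<xi>)) $ i"
\<comment> \<open>\<open>Taylor\<close> requires distinct points; for equal ones the remainder
  vanishes.\<close>
proof (cases "s = c")
  case True
  with c show thesis by (intro that[of c]) auto
next
  case False
  have bl: "bounded_linear A" using A by (rule linear_conv_bounded_linear[THEN iffD1])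
  have comp: "((\<lambda>t. A (g t) $ i) has_real_derivative A d $ i) (at t)"
    if "(g has_vector_derivative d) (at t)" for g d t
    using bounded_linear.has_vector_derivative[OF bounded_linear_vec_nth[of i]
        bounded_linear.has_vector_derivative[OF bl that]]
    by (simp add: has_real_derivative_iff_has_vector_derivative)
  \<comment> \<open>For \<open>m \<le> 2\<close> this is the \<open>m\<close>-th derivative of the
    coordinate. Only orders below 2 get differentiated, so one derivative of \<open>f\<close> is
    enough.\<close>
  define diff where "diff m = (if m = 0 then (\<lambda>t. A (u t) $ i)
    else if m = 1 then (\<lambda>t. A (f (u t)) $ i)
    else (\<lambda>t. A (jacobian f (at (u t)) *v f (u t)) $ i))" for m :: nat
  have "\<forall>m t. m < 2 \<and> a \<le> t \<and> t \<le> b \<longrightarrow> DERIV (diff m) t :> diff (Suc m) t"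
  proof (intro allI impI)
    fix m t assume mt: "m < (2::nat) \<and> a \<le> t \<and> t \<le> b"
    then have t: "(u has_vector_derivative f (u t)) (at t)" using u by simp
    have "((\<lambda>t. f (u t)) has_vector_derivative jacobian f (at (u t)) *v f (u t)) (at t)"
      using has_derivative_compose[OF t[unfolded has_vector_derivative_def]
          C1_has_derivative_jacobian[OF C1]]
      by (simp add: has_vector_derivative_def matrix_vector_mult_scaleR)
    with t mt show "DERIV (diff m) t :> diff (Suc m) t"
      by (cases m) (auto simp: diff_def intro: comp)
  qed
  then obtain \<xi> where "if s < c then s < \<xi> \<and> \<xi> < c else c < \<xi> \<and> \<xi> < s"
    and "A (u s) $ i = (\<Sum>m<2. diff m c / fact m * (s - c) ^ m) + diff 2 \<xi> / fact 2 * (s - c)\<^sup>2"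
    using Taylor[of 2 diff "\<lambda>t. A (u t) $ i" a b c s] False c s by (auto simp: diff_def)
  with c s show thesis
    by (intro that[of \<xi>]) (auto simp: diff_def numeral_2_eq_2 algebra_simps split: if_splits)
qed

section \<open>Correctness of the computed enclosure\<close>

theorem lemma7:
  fixes f :: "real^'n \<Rightarrow> real^'n"
    and \<Pi>\<^sub>1 \<Pi>\<^sub>2 X X\<^sub>1 z :: "(real^'n) set"
    and t\<^sub>1 t\<^sub>2 :: real
    and y :: "real^'n"
    and A :: "real^'n \<Rightarrow> real^'n"
    and fI :: "(real^'n) set \<Rightarrow> (real^'n) set"
    and DfI :: "(real^'n) set \<Rightarrow> (real^'n^'n) set"
  assumes "C1_on f UNIV"
    and "poincare_section f \<Pi>\<^sub>1" and "poincare_section f \<Pi>\<^sub>2"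
    and "X \<subseteq> poincare_domain f \<Pi>\<^sub>1 \<Pi>\<^sub>2"
    and "interval_extension f fI"
    and "interval_extension (\<lambda>x. jacobian f (at x)) DfI"
    and "t\<^sub>1 \<le> t\<^sub>2" and "return_time f \<Pi>\<^sub>2 ` X \<subseteq> {t\<^sub>1..t\<^sub>2}"
    and "flow_maps_into f {t\<^sub>1} X X\<^sub>1"
    and "linear A"
    and "computePoincareMap fI DfI t\<^sub>1 t\<^sub>2 X\<^sub>1 f y A z"
  shows "(\<lambda>x. A (poincare_map f \<Pi>\<^sub>2 x - y)) ` X \<subseteq> z"
proof (rule image_subsetI)
  fix x assume x: "x \<in> X"
  note C1 = assms(1) and A = \<open>linear A\<close>
  define T where "T = return_time f \<Pi>\<^sub>2 x"
  have T: "0 \<le> T" "T \<in> existence_interval f x" "t\<^sub>1 \<le> T" "T \<le> t\<^sub>2"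
    using return_time_in_existence_interval[of f \<Pi>\<^sub>2 x] assms(4,8) x
    by (auto simp: T_def poincare_domain_def)
  define x\<^sub>1 where "x\<^sub>1 = flow f t\<^sub>1 x"
  have x1: "x\<^sub>1 \<in> X\<^sub>1" "t\<^sub>1 \<in> existence_interval f x"
    using assms(9) x by (auto simp: flow_maps_into_def x\<^sub>1_def)
  from assms(11) obtain e t\<^sub>0 \<Delta>t X\<^sub>0 Y\<^sub>0 v Y M\<^sub>1 M\<^sub>2 w D \<Delta>Y Z\<^sub>1 Z\<^sub>2 where
    e: "interval_box e" "flow_maps_into f {0..t\<^sub>2 - t\<^sub>1} X\<^sub>1 e"
    and t0: "t\<^sub>0 = (t\<^sub>1 + t\<^sub>2) / 2"
    and \<Delta>t: "interval_op (-) {t\<^sub>1..t\<^sub>2} {t\<^sub>0} \<Delta>t"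
    and X0: "flow_maps_into f {t\<^sub>0 - t\<^sub>1} X\<^sub>1 X\<^sub>0"
    and Y0: "(\<lambda>x. A (x - y)) ` X\<^sub>0 \<subseteq> Y\<^sub>0"
    and v: "(\<lambda>x. A (f x)) ` X\<^sub>0 \<subseteq> v"
    and Y: "interval_op (\<lambda>a t. t *\<^sub>R a) v \<Delta>t Y"
    and M1: "interval_op (*\<^sub>R) {1/2} {matrix A} M\<^sub>1"
    and M2: "interval_op (**) M\<^sub>1 (DfI e) M\<^sub>2"
    and w: "interval_op (*v) M\<^sub>2 (fI e) w"
    and D: "(\<lambda>t. t\<^sup>2) ` \<Delta>t \<subseteq> D"
    and \<Delta>Y: "interval_op (\<lambda>a t. t *\<^sub>R a) w D \<Delta>Y"
    and Z1: "interval_op (+) Y\<^sub>0 Y Z\<^sub>1"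
    and Z2: "interval_op (+) Z\<^sub>1 \<Delta>Y Z\<^sub>2"
    and z: "z = Z\<^sub>2 \<inter> interval_hull ((\<lambda>x. A (x - y)) ` e)"
    unfolding computePoincareMap_def by blast
  \<comment> \<open>Existence at the last time yields a single solution \<open>u\<close> that covers
    all times used below. Its clock starts at \<open>t\<^sub>1\<close>, so \<open>T\<close> and
    \<open>t\<^sub>0\<close> enter as \<open>T - t\<^sub>1\<close> and
    \<open>t\<^sub>0 - t\<^sub>1\<close>.\<close>
  have "t\<^sub>2 - t\<^sub>1 \<in> existence_interval f x\<^sub>1"
    using e(2) x1(1) \<open>t\<^sub>1 \<le> t\<^sub>2\<close> by (simp add: flow_maps_into_def)
  then obtain I u where u: "ivp_solution f x\<^sub>1 I u" "t\<^sub>2 - t\<^sub>1 \<in> I"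
    unfolding existence_interval_iff by blast
  have I: "t \<in> I" if "t \<in> {0..t\<^sub>2 - t\<^sub>1}" for t
    using mem_is_interval_1_I[of I 0 "t\<^sub>2 - t\<^sub>1" t] u that by (auto simp: ivp_solution_def)
  have u_e: "u t \<in> e" if "t \<in> {0..t\<^sub>2 - t\<^sub>1}" for t
    using e(2) x1(1) that flow_eq_solution[OF C1 u(1) I[OF that]] by (force simp: flow_maps_into_def)
  have du: "(u has_vector_derivative f (u t)) (at t)" if "t \<in> {0..t\<^sub>2 - t\<^sub>1}" for t
    using u(1) I[OF that] by (auto simp: ivp_solution_def)
  have c: "t\<^sub>0 - t\<^sub>1 \<in> {0..t\<^sub>2 - t\<^sub>1}" and s: "T - t\<^sub>1 \<in> {0..t\<^sub>2 - t\<^sub>1}"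
    using T \<open>t\<^sub>1 \<le> t\<^sub>2\<close> by (auto simp: t0 field_simps)
  define p x\<^sub>0 where "p = u (T - t\<^sub>1)" and "x\<^sub>0 = u (t\<^sub>0 - t\<^sub>1)"
  have p: "poincare_map f \<Pi>\<^sub>2 x = p"
    using flow_from_intermediate_point[OF C1 x1(2) T(2,1,3)] u(1) I[OF s]
    by (simp add: poincare_map_def p_def T_def x\<^sub>1_def)
  have x0: "x\<^sub>0 \<in> X\<^sub>0"
    using X0 x1(1) flow_eq_solution[OF C1 u(1) I[OF c]] unfolding flow_maps_into_def x\<^sub>0_def
    by (metis singletonI)
  define \<delta> where "\<delta> = T - t\<^sub>0"
  have \<delta>: "\<delta> \<in> \<Delta>t" using \<Delta>t T by (auto simp: interval_op_def \<delta>_def)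
  \<comment> \<open>The Taylor factor 1/2 is moved into \<open>r\<close>, because \<open>w\<close>
    already contains it through \<open>M\<^sub>1\<close>.\<close>
  have rem: "\<exists>r\<in>w. A p $ i = A x\<^sub>0 $ i + \<delta> * A (f x\<^sub>0) $ i + \<delta>\<^sup>2 * r $ i" for i
  proof -
    obtain \<xi> where \<xi>: "\<xi> \<in> {0..t\<^sub>2 - t\<^sub>1}" and eq: "A p $ i = A x\<^sub>0 $ i + \<delta> * A (f x\<^sub>0) $ i
        + \<delta>\<^sup>2 / 2 * A (jacobian f (at (u \<xi>)) *v f (u \<xi>)) $ i"
      using linear_solution_taylor2[OF C1 A du c s, of i]
      unfolding p_def x\<^sub>0_def \<delta>_def diff_diff_eq2 diff_add_cancel by blast
    \<comment> \<open>The bracketing follows the evaluation order of \<open>M\<^sub>1\<close>,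
      \<open>M\<^sub>2\<close> and \<open>w\<close>, so membership can be read off their
      enclosures.\<close>
    define r where "r = (((1/2) *\<^sub>R matrix A) ** jacobian f (at (u \<xi>))) *v f (u \<xi>)"
    have "jacobian f (at (u \<xi>)) \<in> DfI e" "f (u \<xi>) \<in> fI e"
      using assms(5,6) e(1) u_e[OF \<xi>] unfolding interval_extension_def by blast+
    then have "r \<in> w" using M1 M2 w by (simp add: interval_op_def r_def)
    moreover have "r = (1/2) *\<^sub>R A (jacobian f (at (u \<xi>)) *v f (u \<xi>))"
      unfolding r_def
      by (simp add: matrix_vector_mul_assoc[symmetric] scaleR_matrix_vector_assoc[symmetric]
          matrix_works linear_matrix_vector_mul_eq A)
    ultimately show ?thesis using eq by (intro bexI[of _ r]) auto
  qed
  then obtain r where r: "\<And>i. r i \<in> w"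
    "\<And>i. A p $ i = A x\<^sub>0 $ i + \<delta> * A (f x\<^sub>0) $ i + \<delta>\<^sup>2 * r i $ i" by metis
  \<comment> \<open>The vectors \<open>r i\<close> come from different intermediate times;
    \<open>R\<close> takes the \<open>i\<close>-th entry of the \<open>i\<close>-th one.\<close>
  define R where "R = (\<chi> i. r i $ i)"
  have "R \<in> w"
    using w r(1) by (intro interval_box_componentwise) (auto simp: interval_op_def R_def)
  then have "\<delta>\<^sup>2 *\<^sub>R R \<in> \<Delta>Y" using \<Delta>Y D \<delta> by (auto simp: interval_op_def)
  moreover have "\<delta> *\<^sub>R A (f x\<^sub>0) \<in> Y" using Y v x0 \<delta> by (auto simp: interval_op_def)
  moreover have "A (x\<^sub>0 - y) \<in> Y\<^sub>0" using Y0 x0 by auto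
  ultimately have "A (x\<^sub>0 - y) + \<delta> *\<^sub>R A (f x\<^sub>0) + \<delta>\<^sup>2 *\<^sub>R R \<in> Z\<^sub>2"
    using Z1 Z2 by (auto simp: interval_op_def)
  moreover have "A (p - y) = A (x\<^sub>0 - y) + \<delta> *\<^sub>R A (f x\<^sub>0) + \<delta>\<^sup>2 *\<^sub>R R"
    using r(2) by (simp add: vec_eq_iff R_def linear_diff[OF A])
  \<comment> \<open>The solution stays in \<open>e\<close>, so intersecting with the hull does not
    cut off the image point.\<close>
  moreover have "A (p - y) \<in> interval_hull ((\<lambda>x. A (x - y)) ` e)"
    using u_e[OF s] by (auto simp: interval_hull_def p_def)
  ultimately show "A (poincare_map f \<Pi>\<^sub>2 x - y) \<in> z" by (simp add: z p)
qed

end
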